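(* Let $U/K$ be a symmetric space of rank $n$ with Cartan decomposition $\mathfrak{u}=\mathfrak{k}\oplus\mathfrak{p}$, let $\mathfrak{a}\subset\mathfrak{p}$ be a maximal abelian subalgebra with basis $a_1,\dots,a_n$, and let $U^*/K$ be the dual symmetric space, with Cartan decomposition $\mathfrak{u}^*=\mathfrak{k}\oplus i\mathfrak{p}$, maximal abelian subspace $i\mathfrak{a}\subset i\mathfrak{p}$ and basis $ia_1,\dots,ia_n$. Then $v:\mathbb{R}^n\to\mathfrak{a}^\perp\cap\mathfrak{p}$ is a solution of the $U/K$-system if and only if $-iv:\mathbb{R}^n\to(i\mathfrak{a})^\perp\cap i\mathfrak{p}$ is a solution of the $U^*/K$-system.
   Context: The $n$-dimensional system associated to $U/K$ (the $U/K$-system) is the following system of first order PDEs for a map $v:\mathbb{R}^n\to\mathfrak{a}^\perp\cap\mathfrak{p}$: $$[a_i,v_{x_j}]-[a_j,v_{x_i}]=[[a_i,v],[a_j,v]]\qquad\text{for all } i,j,$$ which is independent of the choice of basis $a_1,\dots,a_n$ of $\mathfrak{a}$. The $U^*/K$-system is the same system with $\mathfrak{p},\mathfrak{a},a_i$ replaced by $i\mathfrak{p},i\mathfrak{a},ia_i$. Here $\mathfrak{k}\oplus i\mathfrak{p}$ is regarded as a real subalgebra of the complexification $\mathfrak{u}\otimes\mathbb{C}$, and $\perp$ is the orthogonal complement with respect to the invariant nondegenerate bilinear form on $\mathfrak{u}$ (extended complex bilinearly to $\mathfrak{u}\otimes\mathbb{C}$). *)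

theory Defs
  imports "HOL-Analysis.Analysis"
begin

text \<open>
  A finite-dimensional real Lie algebra is a bracket on a type of class
  \<open>euclidean_space\<close>.  The inner product of that class is auxiliary: it only provides the
  (unique) vector space topology in which derivatives are taken.
\<close>

definition lie_bracket :: "('a::real_vector \<Rightarrow> 'a \<Rightarrow> 'a) \<Rightarrow> bool" where
  "lie_bracket br \<longleftrightarrow> bilinear br \<and> (\<forall>x. br x x = 0) \<and>
     (\<forall>x y z. br x (br y z) + br y (br z x) + br z (br x y) = 0)"

definition lie_subalgebra :: "('a::real_vector \<Rightarrow> 'a \<Rightarrow> 'a) \<Rightarrow> 'a set \<Rightarrow> bool" where
  "lie_subalgebra br g \<longleftrightarrow> subspace g \<and> (\<forall>x\<in>g. \<forall>y\<in>g. br x y \<in> g)"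

text \<open>
  A symmetric space \<open>U/K\<close> enters through its infinitesimal data: the Lie algebra \<open>g\<close> of \<open>U\<close>,
  here a real subalgebra of an ambient Lie algebra (possibly all of it), and the differential
  \<open>\<sigma>\<close> of the involution.  The Cartan decomposition is the decomposition of \<open>g\<close> into the
  \<open>\<plusminus>1\<close>-eigenspaces of \<open>\<sigma>\<close>, which are \<open>k_part g \<sigma>\<close> and \<open>p_part g \<sigma>\<close>.
\<close>

definition symmetric_lie_algebra ::
  "'a::real_vector set \<Rightarrow> ('a \<Rightarrow> 'a \<Rightarrow> 'a) \<Rightarrow> ('a \<Rightarrow> 'a) \<Rightarrow> bool" where
  "symmetric_lie_algebra g br \<sigma> \<longleftrightarrow> lie_bracket br \<and> lie_subalgebra br g \<and>
     linear \<sigma> \<and> \<sigma> ` g \<subseteq> g \<and> (\<forall>x\<in>g. \<sigma> (\<sigma> x) = x) \<and>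
     (\<forall>x\<in>g. \<forall>y\<in>g. \<sigma> (br x y) = br (\<sigma> x) (\<sigma> y))"

definition k_part :: "'a::real_vector set \<Rightarrow> ('a \<Rightarrow> 'a) \<Rightarrow> 'a set" where
  "k_part g \<sigma> = {x \<in> g. \<sigma> x = x}"

definition p_part :: "'a::real_vector set \<Rightarrow> ('a \<Rightarrow> 'a) \<Rightarrow> 'a set" where
  "p_part g \<sigma> = {x \<in> g. \<sigma> x = - x}"

definition abelian_subspace :: "('a::real_vector \<Rightarrow> 'a \<Rightarrow> 'a) \<Rightarrow> 'a set \<Rightarrow> 'a set \<Rightarrow> bool" where
  "abelian_subspace br p A \<longleftrightarrow> subspace A \<and> A \<subseteq> p \<and> (\<forall>x\<in>A. \<forall>y\<in>A. br x y = 0)"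

definition maximal_abelian :: "('a::real_vector \<Rightarrow> 'a \<Rightarrow> 'a) \<Rightarrow> 'a set \<Rightarrow> 'a set \<Rightarrow> bool" where
  "maximal_abelian br p A \<longleftrightarrow> abelian_subspace br p A \<and>
     (\<forall>A'. abelian_subspace br p A' \<and> A \<subseteq> A' \<longrightarrow> A' = A)"

definition symmetric_rank :: "('a::euclidean_space \<Rightarrow> 'a \<Rightarrow> 'a) \<Rightarrow> 'a set \<Rightarrow> nat" where
  "symmetric_rank br p = Max (dim ` {A. abelian_subspace br p A})"

definition indexed_basis :: "('n \<Rightarrow> 'a::real_vector) \<Rightarrow> 'a set \<Rightarrow> bool" where
  "indexed_basis a A \<longleftrightarrow> inj a \<and> independent (range a) \<and> span (range a) = A"

definition invariant_form :: "('a::real_vector \<Rightarrow> 'a \<Rightarrow> 'a) \<Rightarrow> ('a \<Rightarrow> 'a \<Rightarrow> real) \<Rightarrow> bool" where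
  "invariant_form br B \<longleftrightarrow> bilinear B \<and> (\<forall>x y. B x y = B y x) \<and>
     (\<forall>x y z. B (br x y) z = B x (br y z))"

definition nondegenerate_form :: "('a::real_vector \<Rightarrow> 'a \<Rightarrow> real) \<Rightarrow> bool" where
  "nondegenerate_form B \<longleftrightarrow> (\<forall>x. (\<forall>y. B x y = 0) \<longrightarrow> x = 0)"

text \<open>The values of the form may be real or complex, to cover both a form on a real Lie algebra
  and its bilinear extension to the complexification.\<close>

definition form_perp :: "'a set \<Rightarrow> ('a \<Rightarrow> 'a \<Rightarrow> 'f::zero) \<Rightarrow> 'a set \<Rightarrow> 'a set" where
  "form_perp g B A = {x \<in> g. \<forall>y\<in>A. B x y = 0}"

definition partial_deriv :: "'n \<Rightarrow> (real^'n \<Rightarrow> 'a::real_normed_vector) \<Rightarrow> real^'n \<Rightarrow> 'a" where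
  "partial_deriv j v x = frechet_derivative v (at x) (axis j 1)"

definition symmetric_space_system ::
  "'a::euclidean_space set \<Rightarrow> ('a \<Rightarrow> 'a \<Rightarrow> 'a) \<Rightarrow> ('a \<Rightarrow> 'a) \<Rightarrow> ('a \<Rightarrow> 'a \<Rightarrow> 'f::zero) \<Rightarrow>
   'a set \<Rightarrow> ('n::finite \<Rightarrow> 'a) \<Rightarrow> (real^'n \<Rightarrow> 'a) \<Rightarrow> bool" where
  "symmetric_space_system g br \<sigma> B A a v \<longleftrightarrow>
     (\<forall>x. v x \<in> form_perp g B A \<inter> p_part g \<sigma>) \<and>
     (\<forall>x. v differentiable (at x)) \<and>
     (\<forall>x i j. br (a i) (partial_deriv j v x) - br (a j) (partial_deriv i v x)
              = br (br (a i) (v x)) (br (a j) (v x)))"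

text \<open>The complexification of \<open>'a\<close> is modelled on \<open>'a \<times> 'a\<close>, the pair \<open>(x, y)\<close> standing for
  \<open>x + iy\<close>.\<close>

definition cembed :: "'a::real_vector \<Rightarrow> 'a \<times> 'a" where
  "cembed x = (x, 0)"

definition cscale :: "complex \<Rightarrow> 'a::real_vector \<times> 'a \<Rightarrow> 'a \<times> 'a" where
  "cscale c z = (Re c *\<^sub>R fst z - Im c *\<^sub>R snd z, Re c *\<^sub>R snd z + Im c *\<^sub>R fst z)"

definition cbracket :: "('a::real_vector \<Rightarrow> 'a \<Rightarrow> 'a) \<Rightarrow> 'a \<times> 'a \<Rightarrow> 'a \<times> 'a \<Rightarrow> 'a \<times> 'a" where
  "cbracket br z w = (br (fst z) (fst w) - br (snd z) (snd w),
                      br (fst z) (snd w) + br (snd z) (fst w))"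

definition cform :: "('a \<Rightarrow> 'a \<Rightarrow> real) \<Rightarrow> 'a \<times> 'a \<Rightarrow> 'a \<times> 'a \<Rightarrow> complex" where
  "cform B z w = Complex (B (fst z) (fst w) - B (snd z) (snd w))
                         (B (fst z) (snd w) + B (snd z) (fst w))"

definition cinvolution :: "('a \<Rightarrow> 'a) \<Rightarrow> 'a \<times> 'a \<Rightarrow> 'a \<times> 'a" where
  "cinvolution \<sigma> z = (\<sigma> (fst z), \<sigma> (snd z))"

definition itimes :: "'a::real_vector \<Rightarrow> 'a \<times> 'a" where
  "itimes x = cscale \<i> (cembed x)"

text \<open>The Lie algebra of \<open>U\<^sup>*\<close>; its involution is the restriction of \<open>cinvolution \<sigma>\<close>.\<close>

definition dual_algebra :: "('a::real_vector \<Rightarrow> 'a) \<Rightarrow> ('a \<times> 'a) set" where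
  "dual_algebra \<sigma> = {cembed x + itimes y | x y. x \<in> k_part UNIV \<sigma> \<and> y \<in> p_part UNIV \<sigma>}"

lemma itimes_eq: "itimes x = (0, x)"
  by (simp add: itimes_def cscale_def cembed_def)

lemma dual_algebra_eq: "dual_algebra \<sigma> = k_part UNIV \<sigma> \<times> p_part UNIV \<sigma>"
  by (auto simp: dual_algebra_def itimes_eq cembed_def)

text \<open>The dual data are again those of a symmetric space, with Cartan decomposition
  \<open>\<kk> \<oplus> i\<pp>\<close>, and multiplication by \<open>i\<close> carries the abelian data of one to the other.\<close>

lemma k_part_dual:
  assumes "linear \<sigma>"
  shows "k_part (dual_algebra \<sigma>) (cinvolution \<sigma>) = cembed ` k_part UNIV \<sigma>"
proof -
  have "y = 0" if "\<sigma> y = y" "\<sigma> y = - y" for y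
    using that by (metis eq_neg_iff_add_eq_0 scaleR_2 scaleR_eq_0_iff zero_neq_numeral)
  then show ?thesis
    using linear_0[OF assms]
    by (fastforce simp: k_part_def p_part_def dual_algebra_eq cinvolution_def cembed_def)
qed

lemma p_part_dual:
  assumes "linear \<sigma>"
  shows "p_part (dual_algebra \<sigma>) (cinvolution \<sigma>) = itimes ` p_part UNIV \<sigma>"
proof -
  have "y = 0" if "\<sigma> y = y" "\<sigma> y = - y" for y
    using that by (metis eq_neg_iff_add_eq_0 scaleR_2 scaleR_eq_0_iff zero_neq_numeral)
  then show ?thesis
    using linear_0[OF assms]
    by (fastforce simp: k_part_def p_part_def dual_algebra_eq cinvolution_def itimes_eq)
qed

lemma lie_bracket_cbracket:
  assumes "lie_bracket br"
  shows "lie_bracket (cbracket br)"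
proof -
  have bil: "bilinear br" and alt: "\<And>x. br x x = 0"
    and jac: "\<And>x y z. br x (br y z) + br y (br z x) + br z (br x y) = 0"
    using assms by (auto simp: lie_bracket_def)
  note L = bilinear_ladd[OF bil] bilinear_radd[OF bil] bilinear_lmul[OF bil]
    bilinear_rmul[OF bil] bilinear_lsub[OF bil] bilinear_rsub[OF bil]
  have anti: "br x y + br y x = 0" for x y
    using alt[of "x + y"] unfolding L by (simp add: alt add.commute)
  have 1: "bilinear (cbracket br)"
    by (auto simp: bilinear_def cbracket_def L algebra_simps intro!: linearI)
  have 2: "cbracket br z z = 0" for z
    using anti[of "fst z" "snd z"] by (simp add: cbracket_def alt zero_prod_def)
  have 3: "cbracket br x (cbracket br y z) + cbracket br y (cbracket br z x)
       + cbracket br z (cbracket br x y) = 0" for x y z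
  proof (cases x; cases y; cases z)
    fix x1 x2 y1 y2 z1 z2 assume [simp]: "x = (x1, x2)" "y = (y1, y2)" "z = (z1, z2)"
    let ?J = "\<lambda>x y z. br x (br y z) + br y (br z x) + br z (br x y)"
    have "cbracket br x (cbracket br y z) + cbracket br y (cbracket br z x)
       + cbracket br z (cbracket br x y)
      = (?J x1 y1 z1 - ?J x1 y2 z2 - ?J x2 y1 z2 - ?J x2 y2 z1,
         ?J x1 y1 z2 + ?J x1 y2 z1 + ?J x2 y1 z1 - ?J x2 y2 z2)"
      by (simp add: cbracket_def L algebra_simps)
    then show ?thesis by (simp only: jac) (simp add: zero_prod_def)
  qed
  show ?thesis using 1 2 3 by (auto simp: lie_bracket_def)
qed

lemma symmetric_lie_algebra_dual:
  assumes "symmetric_lie_algebra UNIV br \<sigma>"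
  shows "symmetric_lie_algebra (dual_algebra \<sigma>) (cbracket br) (cinvolution \<sigma>)"
proof -
  have lb: "lie_bracket br" and lin: "linear \<sigma>" and inv: "\<And>x. \<sigma> (\<sigma> x) = x"
    and hom: "\<And>x y. \<sigma> (br x y) = br (\<sigma> x) (\<sigma> y)"
    using assms by (auto simp: symmetric_lie_algebra_def)
  have bil: "bilinear br" using lb by (simp add: lie_bracket_def)
  note L = linear_add[OF lin] linear_diff[OF lin] linear_neg[OF lin] linear_cmul[OF lin] linear_0[OF lin]
  note N = bilinear_lneg[OF bil] bilinear_rneg[OF bil]
  have "lie_subalgebra (cbracket br) (dual_algebra \<sigma>)"
    by (auto simp: lie_subalgebra_def subspace_def dual_algebra_eq k_part_def p_part_def
        cbracket_def L N hom zero_prod_def)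
  moreover have "linear (cinvolution \<sigma>)"
    by (auto simp: cinvolution_def L intro!: linearI)
  moreover have "cinvolution \<sigma> ` dual_algebra \<sigma> \<subseteq> dual_algebra \<sigma>"
    by (auto simp: dual_algebra_eq k_part_def p_part_def cinvolution_def inv L)
  moreover have "cinvolution \<sigma> (cinvolution \<sigma> z) = z" for z
    by (simp add: cinvolution_def inv)
  moreover have "cinvolution \<sigma> (cbracket br z w) = cbracket br (cinvolution \<sigma> z) (cinvolution \<sigma> w)"
    for z w
    by (simp add: cinvolution_def cbracket_def L hom)
  ultimately show ?thesis
    using lie_bracket_cbracket[OF lb] by (auto simp: symmetric_lie_algebra_def)
qed

lemma linear_itimes: "linear itimes"
  by (auto simp: itimes_eq intro!: linearI)

lemma inj_itimes: "inj itimes"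
  by (auto simp: itimes_eq inj_def)

lemma abelian_subspace_itimes:
  assumes "bilinear br"
  shows "abelian_subspace (cbracket br) (itimes ` p) (itimes ` A) \<longleftrightarrow> abelian_subspace br p A"
proof -
  have "subspace (itimes ` A) \<longleftrightarrow> subspace A"
    using linear_subspace_image[OF linear_itimes] linear_subspace_vimage[OF linear_itimes]
    by (metis inj_itimes inj_vimage_image_eq)
  moreover have "itimes ` A \<subseteq> itimes ` p \<longleftrightarrow> A \<subseteq> p"
    by (simp add: inj_image_subset_iff inj_itimes)
  moreover have "cbracket br (itimes x) (itimes y) = 0 \<longleftrightarrow> br x y = 0" for x y
    by (simp add: cbracket_def itimes_eq bilinear_lzero[OF assms] bilinear_rzero[OF assms]
        zero_prod_def)
  ultimately show ?thesis by (simp add: abelian_subspace_def)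
qed

lemma maximal_abelian_dual:
  assumes "symmetric_lie_algebra UNIV br \<sigma>" "maximal_abelian br (p_part UNIV \<sigma>) A"
  shows "maximal_abelian (cbracket br) (p_part (dual_algebra \<sigma>) (cinvolution \<sigma>)) (itimes ` A)"
proof -
  have bil: "bilinear br" and lin: "linear \<sigma>"
    using assms by (auto simp: symmetric_lie_algebra_def lie_bracket_def)
  have "A' = itimes ` A"
    if *: "abelian_subspace (cbracket br) (itimes ` p_part UNIV \<sigma>) A'" "itimes ` A \<subseteq> A'" for A'
  proof -
    obtain C where C: "A' = itimes ` C"
      using * by (metis abelian_subspace_def subset_imageE)
    then have "C = A"
      using * assms(2) abelian_subspace_itimes[OF bil]
      by (metis inj_image_subset_iff inj_itimes maximal_abelian_def)
    then show ?thesis using C by simp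
  qed
  then show ?thesis
    using assms(2) unfolding p_part_dual[OF lin] maximal_abelian_def
    by (simp add: abelian_subspace_itimes[OF bil])
qed

lemma indexed_basis_dual:
  assumes "indexed_basis a A"
  shows "indexed_basis (\<lambda>i. itimes (a i)) (itimes ` A)"
proof -
  have r: "range (\<lambda>i. itimes (a i)) = itimes ` range a" by auto
  have "independent (itimes ` range a)"
    using assms linear_independent_injective_image[OF linear_itimes] inj_itimes
    by (metis indexed_basis_def inj_on_subset subset_UNIV)
  moreover have "span (itimes ` range a) = itimes ` A"
    using assms linear_span_image[OF linear_itimes, of "range a"] by (auto simp: indexed_basis_def)
  moreover have "inj (\<lambda>i. itimes (a i))"
    using assms inj_itimes by (auto simp: indexed_basis_def inj_def)
  ultimately show ?thesis by (simp add: indexed_basis_def r)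
qed

end

theory Submission
  imports Defs
begin

text \<open>Since \<open>[ix, -iy] = [x, y]\<close>, and likewise for the bilinear form, the substitution
  \<open>a\<^sub>i \<mapsto> ia\<^sub>i\<close>, \<open>v \<mapsto> -iv\<close> leaves each term of the system unchanged.\<close>

text \<open>Puts \<open>-ix\<close> into coordinates; the lemmas below work with the pair
  \<open>(0, - x)\<close> directly.\<close>

lemma cscale_minus_i_cembed: "cscale (- \<i>) (cembed x) = (0, - x)"
  by (simp add: cscale_def cembed_def)

lemma cbracket_itimes_minus_i:
  assumes "bilinear br"
  shows "cbracket br (itimes x) (0, - y) = cembed (br x y)"
  by (simp add: cbracket_def itimes_eq cembed_def bilinear_lzero[OF assms]
      bilinear_rzero[OF assms] bilinear_rneg[OF assms])

text \<open>Handles the outer bracket of the quadratic term: both inner brackets are already real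
  there.\<close>

lemma cbracket_cembed:
  assumes "bilinear br"
  shows "cbracket br (cembed x) (cembed y) = cembed (br x y)"
  by (simp add: cbracket_def cembed_def bilinear_lzero[OF assms] bilinear_rzero[OF assms])

lemma cform_minus_i_itimes:
  assumes "bilinear B"
  shows "cform B (0, - x) (itimes y) = of_real (B x y)"
  by (simp add: cform_def itimes_eq bilinear_lzero[OF assms] bilinear_rzero[OF assms]
      bilinear_lneg[OF assms] complex_of_real_def)

lemma minus_i_mem_perp_Int_p_part_dual:
  assumes "linear \<sigma>" and "bilinear B"
  shows "(0, - x) \<in> form_perp (dual_algebra \<sigma>) (cform B) (itimes ` A)
                    \<inter> p_part (dual_algebra \<sigma>) (cinvolution \<sigma>)
    \<longleftrightarrow> x \<in> form_perp UNIV B A \<inter> p_part UNIV \<sigma>"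
proof -
  \<comment> \<open>The ambient sets of the two complements differ:
    \<open>dual_algebra \<sigma>\<close> already forces \<open>x\<close> into the
    \<open>-1\<close>-eigenspace, while \<open>UNIV\<close> forces nothing. The intersection with
    \<open>p_part\<close> evens this out.\<close>
  have "(0, - x) \<in> dual_algebra \<sigma> \<longleftrightarrow> x \<in> p_part UNIV \<sigma>"
    using linear_0[OF assms(1)] linear_neg[OF assms(1)]
    by (auto simp: dual_algebra_eq k_part_def p_part_def minus_equation_iff)
  moreover have "(0, - x) \<in> p_part (dual_algebra \<sigma>) (cinvolution \<sigma>) \<longleftrightarrow> x \<in> p_part UNIV \<sigma>"
    unfolding p_part_dual[OF assms(1)]
    by (auto simp: itimes_eq p_part_def image_iff linear_neg[OF assms(1)] minus_equation_iff
        intro!: exI[of _ "- x"])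
  ultimately show ?thesis
    by (auto simp: form_perp_def cform_minus_i_itimes[OF assms(2)])
qed

lemma has_derivative_Pair_zero_minus:
  assumes "(v has_derivative v') (at x within S)"
  shows "((\<lambda>x. (0, - v x)) has_derivative (\<lambda>h. (0, - v' h))) (at x within S)"
  by (intro has_derivative_Pair has_derivative_const has_derivative_minus assms)

lemma differentiable_Pair_zero_minus_iff:
  "(\<lambda>x. (0::'c::real_normed_vector, - v x)) differentiable (at x within S)
    \<longleftrightarrow> v differentiable (at x within S)"
proof
  assume "(\<lambda>x. (0::'c, - v x)) differentiable (at x within S)"
  then obtain D where "((\<lambda>x. (0::'c, - v x)) has_derivative D) (at x within S)"
    by (auto simp: differentiable_def)
  \<comment> \<open>\<open>v\<close> is recovered as minus the second component.\<close>
  from has_derivative_minus[OF has_derivative_snd[OF this]] show "v differentiable (at x within S)"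
    by (auto simp: differentiable_def)
qed (auto simp: differentiable_def intro: has_derivative_Pair_zero_minus)

text \<open>\<open>frechet_derivative\<close> is a choice operator, so its value is known only where
  a derivative exists; there, uniqueness of the derivative gives the formula.\<close>

lemma partial_deriv_Pair_zero_minus:
  assumes "v differentiable (at x)"
  shows "partial_deriv j (\<lambda>x. (0, - v x)) x = (0, - partial_deriv j v x)"
  by (simp add: partial_deriv_def frechet_derivative_at[OF has_derivative_Pair_zero_minus
        [OF assms[unfolded frechet_derivative_works]], symmetric])

theorem lemma7p1:
  fixes br :: "'a::euclidean_space \<Rightarrow> 'a \<Rightarrow> 'a"
    and \<sigma> :: "'a \<Rightarrow> 'a"
    and B :: "'a \<Rightarrow> 'a \<Rightarrow> real"
    and A :: "'a set"
    and a :: "'n::finite \<Rightarrow> 'a"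
    and v :: "real^'n \<Rightarrow> 'a"
  assumes "symmetric_lie_algebra UNIV br \<sigma>"
    and "invariant_form br B" and "nondegenerate_form B"
    and "symmetric_rank br (p_part UNIV \<sigma>) = CARD('n)"
    and "maximal_abelian br (p_part UNIV \<sigma>) A"
    and "indexed_basis a A"
  shows "symmetric_space_system UNIV br \<sigma> B A a v \<longleftrightarrow>
    symmetric_space_system (dual_algebra \<sigma>) (cbracket br) (cinvolution \<sigma>) (cform B)
      (itimes ` A) (\<lambda>i. itimes (a i)) (\<lambda>x. cscale (- \<i>) (cembed (v x)))"
proof -
  have bil: "bilinear br" and lin: "linear \<sigma>" and bilB: "bilinear B"
    using assms by (auto simp: symmetric_lie_algebra_def lie_bracket_def invariant_form_def)
  have cembed_diff: "cembed x - cembed y = cembed (x - y)" for x y :: 'a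
    by (simp add: cembed_def)
  have cembed_inject: "cembed x = cembed y \<longleftrightarrow> x = y" for x y :: 'a
    by (simp add: cembed_def)
  show ?thesis
    \<comment> \<open>After this rewriting both sides contain the same membership and
      differentiability conditions on \<open>v\<close>. The latter license the formula for the
      partial derivatives; both sides of each dual equation then lie in the image of
      \<open>cembed\<close>, which cancels by injectivity.\<close>
    unfolding symmetric_space_system_def cscale_minus_i_cembed
      minus_i_mem_perp_Int_p_part_dual[OF lin bilB] differentiable_Pair_zero_minus_iff
    by (auto simp: partial_deriv_Pair_zero_minus cbracket_itimes_minus_i[OF bil]
        cbracket_cembed[OF bil] cembed_diff cembed_inject)
qed

end
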